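(* Let $A, E\in\mathbb{C}^{m\times n}$ with $A\neq 0$, let $r=\operatorname{rank}(E)\le\min\{m,n\}$, and suppose $\epsilon=\|E\|_2/\|A\|_2<1$. Then $$\frac{1}{1+\epsilon}\left(\sqrt{\operatorname{sr}(A)}-\sqrt{r}\,\epsilon\right)\le\sqrt{\operatorname{sr}(A+E)}\le\frac{1}{1-\epsilon}\left(\sqrt{\operatorname{sr}(A)}+\sqrt{r}\,\epsilon\right).$$ If also $m=n$ and $A,E\in\mathbb{C}^{n\times n}$ are Hermitian positive semi-definite, then $$\frac{\sqrt{\operatorname{sr}(A)}}{1+\epsilon}\le\sqrt{\operatorname{sr}(A+E)}\le\sqrt{\operatorname{sr}(A)}+\sqrt{r}\,\epsilon.$$
   Context: The stable rank of a non-zero matrix $A\in\mathbb{C}^{m\times n}$ is $\operatorname{sr}(A)=\|A\|_F^2/\|A\|_2^2$, where $\|A\|_F$ is the Frobenius norm and $\|A\|_2$ the operator two-norm (largest singular value). For the zero matrix, $\operatorname{sr}(0)=0$. *)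

theory Defs
  imports "HOL-Analysis.Analysis"
begin

definition frobenius_norm :: "complex ^ 'n ^ 'm \<Rightarrow> real"
  where "frobenius_norm A = sqrt (\<Sum>i\<in>UNIV. \<Sum>j\<in>UNIV. (cmod (A $ i $ j))\<^sup>2)"

text \<open>The library norm on \<^typ>\<open>complex ^ 'n\<close> is the Euclidean one, so the library's
  operator norm of \<open>x \<mapsto> A *v x\<close> is the operator two-norm of \<open>A\<close>; the vectors \<open>x\<close> range
  over all complex vectors.\<close>

definition two_norm :: "complex ^ 'n ^ 'm \<Rightarrow> real"
  where "two_norm A = onorm (\<lambda>x. A *v x)"

definition stable_rank :: "complex ^ 'n ^ 'm \<Rightarrow> real"
  where "stable_rank A = (if A = 0 then 0 else (frobenius_norm A)\<^sup>2 / (two_norm A)\<^sup>2)"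

definition conj_transpose :: "complex ^ 'n ^ 'm \<Rightarrow> complex ^ 'm ^ 'n"
  where "conj_transpose A = map_matrix cnj (transpose A)"

definition hermitian :: "complex ^ 'n ^ 'n \<Rightarrow> bool"
  where "hermitian A \<longleftrightarrow> conj_transpose A = A"

text \<open>For Hermitian \<open>A\<close> the form \<open>x\<^sup>* A x\<close> is real, so taking the real part loses nothing.\<close>

definition hermitian_psd :: "complex ^ 'n ^ 'n \<Rightarrow> bool"
  where "hermitian_psd A \<longleftrightarrow>
    hermitian A \<and> (\<forall>x. 0 \<le> Re (\<Sum>i\<in>UNIV. cnj (x $ i) * (A *v x) $ i))"

lemma frobenius_norm_eq_norm: "frobenius_norm A = norm A"
  by (simp add: frobenius_norm_def norm_vec_def L2_set_def sum_nonneg)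

lemma hermitian_form_real:
  assumes "hermitian A"
  shows "(\<Sum>i\<in>UNIV. cnj (x $ i) * (A *v x) $ i) \<in> \<real>"
proof -
  have A: "cnj (A $ i $ j) = A $ j $ i" for i j
    using assms unfolding hermitian_def conj_transpose_def
    by (simp add: vec_eq_iff transpose_def)
  have "cnj (\<Sum>i\<in>UNIV. cnj (x $ i) * (A *v x) $ i)
      = (\<Sum>i\<in>UNIV. \<Sum>j\<in>UNIV. x $ i * (A $ j $ i * cnj (x $ j)))"
    by (simp add: matrix_vector_mult_def A sum_distrib_left)
  also have "\<dots> = (\<Sum>j\<in>UNIV. \<Sum>i\<in>UNIV. x $ i * (A $ j $ i * cnj (x $ j)))"
    by (rule sum.swap)
  also have "\<dots> = (\<Sum>i\<in>UNIV. cnj (x $ i) * (A *v x) $ i)"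
    by (simp add: matrix_vector_mult_def sum_distrib_left ac_simps)
  finally show ?thesis
    by (simp add: Reals_cnj_iff)
qed

lemma rank_le_min: "rank (E :: complex ^ 'n ^ 'm) \<le> min CARD('m) CARD('n)"
proof -
  have rows: "rows E = range (\<lambda>i. row i E)"
    by (auto simp: rows_def)
  have "rank E \<le> card (rows E)"
    unfolding row_rank_def_gen by (rule vec.dim_le_card') (simp add: rows)
  also have "\<dots> \<le> CARD('m)"
    unfolding rows by (rule card_image_le) simp
  finally have "rank E \<le> CARD('m)" .
  moreover have "rank E \<le> CARD('n)"
    unfolding row_rank_def_gen
    using vec.dim_subset[OF subset_UNIV, of "rows E"] by (simp only: vec_dim_card)
  ultimately show ?thesis by simp
qed

end

theory Submission
  imports Defs
begin

text \<open>The square root of the stable rank is the Frobenius norm over the two-norm, so both pairs of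
  bounds follow from triangle inequalities, the bound \<open>\<parallel>E\<parallel>\<^sub>F \<le> \<surd>(rank E) \<parallel>E\<parallel>\<^sub>2\<close> and, in the
  positive semi-definite case, monotonicity of both norms. Everything is done in the real Euclidean
  structure of the complex vectors: there a matrix has twice its squared Frobenius norm as its
  squared Hilbert-Schmidt norm, and the row space has real dimension at most \<open>2 rank E\<close>. Summing
  over an orthonormal basis of the range of the adjoint then gives the rank bound. Frobenius
  monotonicity amounts to \<open>tr (A E) \<ge> 0\<close>, two-norm monotonicity to the Cauchy-Schwarz
  inequality for the form of \<open>A\<close>.\<close>

section \<open>Orthonormal expansions and the Hilbert-Schmidt norm\<close>

text \<open>The difference of \<open>x\<close> and its expansion in \<open>C\<close> lies in
  \<open>span C\<close> and is orthogonal to all of \<open>C\<close>, hence to itself, so it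
  vanishes.\<close>

lemma parseval_orthonormal_span:
  fixes x :: "'a::euclidean_space"
  assumes "finite C" and orth: "pairwise orthogonal C" and unit: "\<And>c. c \<in> C \<Longrightarrow> norm c = 1"
    and x: "x \<in> span C"
  shows "(norm x)\<^sup>2 = (\<Sum>c\<in>C. (c \<bullet> x)\<^sup>2)"
proof -
  define y where "y = (\<Sum>c\<in>C. (c \<bullet> x) *\<^sub>R c)"
  have "c \<bullet> (x - y) = 0" if "c \<in> C" for c
  proof -
    have "c \<bullet> y = (\<Sum>d\<in>C. if d = c then c \<bullet> x else 0)"
      unfolding y_def inner_sum_right
      by (rule sum.cong)
        (use that orth unit in \<open>auto simp: pairwise_def orthogonal_def dot_square_norm\<close>)
    then show ?thesis
      using that \<open>finite C\<close> by (simp add: inner_diff_right)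
  qed
  then have "orthogonal (x - y) c" if "c \<in> C" for c
    using that by (simp add: orthogonal_def inner_commute)
  moreover have "x - y \<in> span C"
    unfolding y_def by (intro span_diff x span_sum span_scale span_base)
  ultimately have "orthogonal (x - y) (x - y)"
    by (metis orthogonal_to_span)
  then have "x = y"
    by (simp add: orthogonal_def)
  then have "(norm x)\<^sup>2 = x \<bullet> y"
    by (simp add: dot_square_norm)
  then show ?thesis
    by (simp add: y_def inner_sum_right power2_eq_square inner_commute)
qed

lemma sum_Basis_inner_square: "(\<Sum>b\<in>Basis. (b \<bullet> x)\<^sup>2) = (norm (x::'a::euclidean_space))\<^sup>2"
  by (metis (no_types, lifting) euclidean_inner inner_commute power2_eq_square
      power2_norm_eq_inner sum.cong)

text \<open>The Hilbert-Schmidt norm is the same for \<open>f\<close> and its adjoint. Passing to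
  the adjoint and back replaces \<open>Basis\<close> by an orthonormal basis \<open>C\<close> of the
  adjoint's range, and each of the \<open>card C\<close> unit vectors contributes at most the
  squared operator norm.\<close>

lemma sum_norm_square_le_dim_range_adjoint:
  fixes f :: "'a::euclidean_space \<Rightarrow> 'b::euclidean_space"
  assumes f: "linear f"
  shows "(\<Sum>b\<in>Basis. (norm (f b))\<^sup>2) \<le> real (dim (range (adjoint f))) * (onorm f)\<^sup>2"
proof -
  let ?g = "adjoint f"
  obtain C where C: "pairwise orthogonal C" "\<And>c. c \<in> C \<Longrightarrow> norm c = 1" "independent C"
    "card C = dim (span (range ?g))" "span C = span (range ?g)"
    using orthonormal_basis_subspace[of "span (range ?g)"] by (metis subspace_span)
  have "finite C"
    using C(3) by (rule independent_imp_finite)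
  have bl: "bounded_linear f"
    using f by (simp add: linear_conv_bounded_linear)
  have "(\<Sum>b\<in>Basis. (norm (f b))\<^sup>2) = (\<Sum>b\<in>Basis. \<Sum>w\<in>Basis. (w \<bullet> f b)\<^sup>2)"
    by (simp add: sum_Basis_inner_square)
  also have "\<dots> = (\<Sum>w\<in>Basis. \<Sum>b\<in>Basis. (w \<bullet> f b)\<^sup>2)"
    by (rule sum.swap)
  also have "\<dots> = (\<Sum>w\<in>Basis. \<Sum>b\<in>Basis. (b \<bullet> ?g w)\<^sup>2)"
    by (simp add: adjoint_works[OF f] inner_commute)
  also have "\<dots> = (\<Sum>w\<in>Basis. (norm (?g w))\<^sup>2)"
    by (simp add: sum_Basis_inner_square)
  \<comment> \<open>Each \<open>?g w\<close> lies in \<open>span C\<close>, so its norm can be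
    computed from its coordinates in \<open>C\<close> alone.\<close>
  also have "\<dots> = (\<Sum>w\<in>Basis. \<Sum>c\<in>C. (c \<bullet> ?g w)\<^sup>2)"
    by (intro sum.cong refl parseval_orthonormal_span \<open>finite C\<close> C) (auto simp: C span_base)
  also have "\<dots> = (\<Sum>c\<in>C. \<Sum>w\<in>Basis. (w \<bullet> f c)\<^sup>2)"
    by (subst sum.swap) (simp add: adjoint_works[OF f] inner_commute)
  also have "\<dots> = (\<Sum>c\<in>C. (norm (f c))\<^sup>2)"
    by (simp add: sum_Basis_inner_square)
  also have "\<dots> \<le> (\<Sum>c\<in>C. (onorm f)\<^sup>2)"
    using onorm[OF bl] C(2) by (intro sum_mono power_mono) (metis mult.right_neutral, simp)
  also have "\<dots> = real (dim (range ?g)) * (onorm f)\<^sup>2"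
    by (simp add: C(4))
  finally show ?thesis .
qed

section \<open>Real dimension against complex dimension, and the rank\<close>

text \<open>A complex basis together with its multiples by \<open>\<i>\<close> spans over the reals:
  split each complex coefficient into real and imaginary part.\<close>

lemma dim_complex_span_le: "dim (vec.span S) \<le> 2 * vec.dim (S :: (complex ^ 'n) set)"
proof -
  obtain B where B: "B \<subseteq> S" "vec.independent B" "S \<subseteq> vec.span B" "card B = vec.dim S"
    by (rule vec.basis_exists)
  have "finite B"
    using B(2) by (rule vec.finiteI_independent)
  let ?R = "B \<union> (*s) \<i> ` B"
  have "v \<in> span ?R" if "v \<in> vec.span B" for v
    using that
  proof (induction rule: vec.span_induct_alt)
    case base
    show ?case by (rule span_zero)
  next
    case (step c x y)
    have "c *s x = Re c *\<^sub>R x + Im c *\<^sub>R (\<i> *s x)"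
      by (auto simp: vec_eq_iff complex_eq_iff)
    moreover have "x \<in> span ?R" "\<i> *s x \<in> span ?R"
      using step(1) by (auto intro: span_base)
    ultimately show ?case
      using step(2) by (metis span_add span_scale)
  qed
  moreover have "vec.span S \<subseteq> vec.span B"
    using B(3) vec.subspace_span by (rule vec.span_minimal)
  ultimately have "vec.span S \<subseteq> span ?R" by blast
  then have "dim (vec.span S) \<le> card ?R"
    using \<open>finite B\<close> by (intro dim_le_card) auto
  also have "\<dots> \<le> card B + card ((*s) \<i> ` B)"
    by (rule card_Un_le)
  also have "\<dots> \<le> 2 * card B"
    using card_image_le[OF \<open>finite B\<close>, of "(*s) \<i>"] by simp
  finally show ?thesis
    by (simp add: B(4))
qed

lemma inner_complex_eq: "(x::complex) \<bullet> y = Re (cnj x * y)"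
  by (simp add: inner_complex_def)

lemma inner_matrix_vector_conj_transpose:
  fixes A :: "complex ^ 'n ^ 'm"
  shows "(A *v x) \<bullet> y = x \<bullet> (conj_transpose A *v y)"
proof -
  have "(A *v x) \<bullet> y = Re (\<Sum>i\<in>UNIV. \<Sum>j\<in>UNIV. cnj (A $ i $ j) * cnj (x $ j) * y $ i)"
    by (simp add: inner_vec_def inner_complex_eq matrix_vector_mult_def sum_distrib_right)
  also have "\<dots> = Re (\<Sum>j\<in>UNIV. \<Sum>i\<in>UNIV. cnj (A $ i $ j) * cnj (x $ j) * y $ i)"
    by (subst sum.swap) simp
  also have "\<dots> = x \<bullet> (conj_transpose A *v y)"
    by (simp add: inner_vec_def inner_complex_eq matrix_vector_mult_def conj_transpose_def
        transpose_def sum_distrib_left algebra_simps)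
  finally show ?thesis .
qed

text \<open>The adjoint is the conjugate transpose, whose values are entrywise conjugates of complex
  combinations of the rows of \<open>E\<close>. Conjugation \<open>h\<close> is linear over the
  reals, so it does not raise the real dimension.\<close>

lemma dim_range_adjoint_le_rank:
  fixes E :: "complex ^ 'n ^ 'm"
  shows "dim (range (adjoint ((*v) E))) \<le> 2 * rank E"
proof -
  define h :: "complex ^ 'n \<Rightarrow> complex ^ 'n" where "h v = (\<chi> j. cnj (v $ j))" for v
  have "linear h"
    by (auto simp: h_def linear_iff vec_eq_iff)
  have adj: "adjoint ((*v) E) = (*v) (conj_transpose E)"
    by (intro adjoint_unique allI inner_matrix_vector_conj_transpose)
  have "conj_transpose E *v y \<in> h ` vec.span (rows E)" for y
  proof
    show "conj_transpose E *v y = h (\<Sum>i\<in>UNIV. cnj (y $ i) *s row i E)"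
      by (simp add: h_def vec_eq_iff matrix_vector_mult_def conj_transpose_def transpose_def
          row_def mult.commute)
    show "(\<Sum>i\<in>UNIV. cnj (y $ i) *s row i E) \<in> vec.span (rows E)"
      by (intro vec.span_sum vec.span_scale vec.span_base) (auto simp: rows_def)
  qed
  then have "range (adjoint ((*v) E)) \<subseteq> h ` vec.span (rows E)"
    by (auto simp: adj)
  then have "dim (range (adjoint ((*v) E))) \<le> dim (h ` vec.span (rows E))"
    by (rule dim_subset)
  also have "\<dots> \<le> dim (vec.span (rows E))"
    using \<open>linear h\<close> by (rule dim_image_le)
  also have "\<dots> \<le> 2 * rank E"
    unfolding row_rank_def_gen by (rule dim_complex_span_le)
  finally show ?thesis .
qed

text \<open>The factor 2 is the real dimension of the complex numbers: each coordinate contributes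
  the basis vectors with entry \<open>1\<close> and \<open>\<i>\<close>.\<close>

lemma sum_Basis_inner_matrix:
  fixes A E :: "complex ^ 'n ^ 'm"
  shows "(\<Sum>b\<in>Basis. (A *v b) \<bullet> (E *v b)) = 2 * (A \<bullet> E)"
proof -
  have ax: "(M *v axis j u) $ i = M $ i $ j * u" for M :: "complex ^ 'n ^ 'm" and i j u
  proof -
    have "(M *v axis j u) $ i = (\<Sum>k\<in>UNIV. if k = j then M $ i $ j * u else 0)"
      by (simp add: matrix_vector_mult_def axis_def if_distrib cong: if_cong)
    then show ?thesis by simp
  qed
  have "(\<Sum>b\<in>Basis. (A *v b) \<bullet> (E *v b))
      = (\<Sum>j\<in>UNIV. \<Sum>u\<in>Basis. (A *v axis j u) \<bullet> (E *v axis j u))"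
    unfolding Basis_vec_def
    by (subst sum.UNION_disjoint; (subst sum.UNION_disjoint)?) (auto simp: axis_eq_axis)
  also have "\<dots> = (\<Sum>j\<in>UNIV. \<Sum>i\<in>UNIV. 2 * (A $ i $ j \<bullet> E $ i $ j))"
    by (simp add: Basis_complex_def inner_vec_def ax inner_complex_def sum.distrib[symmetric]
        algebra_simps)
  also have "\<dots> = 2 * (A \<bullet> E)"
    by (subst sum.swap) (simp add: inner_vec_def sum_distrib_left)
  finally show ?thesis .
qed

text \<open>The factor 2 in the Hilbert-Schmidt norm cancels the factor 2 in the real
  dimension.\<close>

lemma frobenius_norm_le_rank_two_norm:
  fixes E :: "complex ^ 'n ^ 'm"
  shows "frobenius_norm E \<le> sqrt (real (rank E)) * two_norm E"
proof -
  have lin: "linear ((*v) E)"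
    by simp
  have "2 * (norm E)\<^sup>2 = (\<Sum>b\<in>Basis. (norm (E *v b))\<^sup>2)"
    using sum_Basis_inner_matrix[of E E] by (simp add: power2_norm_eq_inner)
  also have "\<dots> \<le> real (dim (range (adjoint ((*v) E)))) * (onorm ((*v) E))\<^sup>2"
    using lin by (rule sum_norm_square_le_dim_range_adjoint)
  also have "\<dots> \<le> real (2 * rank E) * (onorm ((*v) E))\<^sup>2"
    using dim_range_adjoint_le_rank[of E] by (intro mult_right_mono) auto
  finally have "(norm E)\<^sup>2 \<le> (sqrt (real (rank E)) * two_norm E)\<^sup>2"
    by (simp add: two_norm_def power_mult_distrib)
  then show ?thesis
    unfolding frobenius_norm_eq_norm
    by (rule power2_le_imp_le) (simp add: two_norm_def onorm_pos_le)
qed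

section \<open>Positive self-adjoint operators on real inner product spaces\<close>

text \<open>Symmetry is a separate clause because over the reals a nonnegative quadratic form does
  not force it.\<close>

definition pos_selfadjoint :: "('a::real_inner \<Rightarrow> 'a) \<Rightarrow> bool"
  where "pos_selfadjoint f \<longleftrightarrow>
    linear f \<and> (\<forall>x y. f x \<bullet> y = x \<bullet> f y) \<and> (\<forall>x. 0 \<le> f x \<bullet> x)"

lemma pos_selfadjoint_nonneg: "pos_selfadjoint f \<Longrightarrow> 0 \<le> f x \<bullet> x"
  unfolding pos_selfadjoint_def by blast

text \<open>The form at \<open>x + t *\<^sub>R y\<close> is a nonnegative polynomial in
  \<open>t\<close> of degree at most two.\<close>

lemma pos_selfadjoint_Cauchy_Schwarz:
  assumes "pos_selfadjoint f"
  shows "(f x \<bullet> y)\<^sup>2 \<le> (f x \<bullet> x) * (f y \<bullet> y)"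
proof -
  interpret linear f
    using assms by (simp add: pos_selfadjoint_def)
  let ?a = "f x \<bullet> x" and ?b = "f x \<bullet> y" and ?c = "f y \<bullet> y"
  have "f y \<bullet> x = ?b"
    using assms by (metis pos_selfadjoint_def inner_commute)
  then have quad: "f (x + t *\<^sub>R y) \<bullet> (x + t *\<^sub>R y) = ?a + 2 * t * ?b + t\<^sup>2 * ?c" for t
    by (simp add: add scale inner_add_left inner_add_right power2_eq_square algebra_simps)
  have pos: "0 \<le> ?a + 2 * t * ?b + t\<^sup>2 * ?c" for t
    using assms quad[of t] by (metis pos_selfadjoint_def)
  show ?thesis
  proof (cases "?c = 0")
    case True
    have "?b = 0"
    proof (rule ccontr)
      assume "?b \<noteq> 0"
      then show False
        \<comment> \<open>With \<open>?c = 0\<close> the polynomial is affine, and this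
          \<open>t\<close> gives it the value -1.\<close>
        using pos[of "- (?a + 1) / (2 * ?b)"] True by (simp add: field_simps)
    qed
    then show ?thesis using True by simp
  next
    case False
    moreover have "0 \<le> ?c"
      using assms by (rule pos_selfadjoint_nonneg)
    ultimately have "0 < ?c" by simp
    then show ?thesis
      \<comment> \<open>This \<open>t\<close> is the minimizer of the quadratic.\<close>
      using pos[of "- ?b / ?c"] by (simp add: field_simps power2_eq_square)
  qed
qed

lemma pos_selfadjoint_eq_0:
  assumes "pos_selfadjoint f" "f x \<bullet> x = 0"
  shows "f x = 0"
  using pos_selfadjoint_Cauchy_Schwarz[OF assms(1), of x "f x"] assms(2) by simp

text \<open>This is the Schur complement step: the form of \<open>g\<close> at \<open>x\<close>
  equals the form of \<open>f\<close> at \<open>x\<close> minus a suitable multiple of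
  \<open>k\<close>.\<close>

lemma pos_selfadjoint_deflate:
  assumes f: "pos_selfadjoint f" and k: "f k \<noteq> 0"
  defines "g \<equiv> \<lambda>x. f x - ((f x \<bullet> k) / (f k \<bullet> k)) *\<^sub>R f k"
  shows "pos_selfadjoint g"
proof -
  interpret linear f
    using f by (simp add: pos_selfadjoint_def)
  have sym: "f x \<bullet> y = x \<bullet> f y" and pos: "0 \<le> f x \<bullet> x" for x y
    using f by (auto simp: pos_selfadjoint_def)
  have k0: "f k \<bullet> k \<noteq> 0"
    using pos_selfadjoint_eq_0[OF f] k by blast
  have "linear g"
    by (auto simp: g_def linear_iff add scale inner_add_left algebra_simps add_divide_distrib)
  moreover have "g x \<bullet> y = x \<bullet> g y" for x y
  proof -
    have "f k \<bullet> y = f y \<bullet> k" "x \<bullet> f k = f x \<bullet> k"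
      by (metis sym inner_commute)+
    then show ?thesis
      by (simp add: g_def inner_diff_left inner_diff_right sym[of x y])
  qed
  moreover have "0 \<le> g x \<bullet> x" for x
  proof -
    \<comment> \<open>This coefficient makes \<open>x - t *\<^sub>R k\<close> orthogonal to
      \<open>k\<close> in the form of \<open>f\<close>.\<close>
    define t where "t = (f x \<bullet> k) / (f k \<bullet> k)"
    have fk: "f x \<bullet> k = t * (f k \<bullet> k)"
      using k0 by (simp add: t_def)
    have "f k \<bullet> x = f x \<bullet> k"
      by (metis sym inner_commute)
    then have "g x \<bullet> x = f (x - t *\<^sub>R k) \<bullet> (x - t *\<^sub>R k)"
      unfolding g_def t_def[symmetric]
      by (simp add: diff scale inner_diff_left inner_diff_right fk algebra_simps)
    then show ?thesis using pos by metis
  qed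
  ultimately show ?thesis by (simp add: pos_selfadjoint_def)
qed

text \<open>Cholesky-style elimination: subtracting a positive rank-one part from \<open>f\<close> kills \<open>f k\<close>
  for one basis vector \<open>k\<close> and revives no other one.\<close>

lemma pos_selfadjoint_trace_nonneg:
  fixes f g :: "'a::euclidean_space \<Rightarrow> 'a"
  assumes "pos_selfadjoint f" and g: "pos_selfadjoint g"
  shows "0 \<le> (\<Sum>b\<in>Basis. f b \<bullet> g b)"
  using assms(1)
proof (induction "card {b \<in> Basis. f b \<noteq> 0}" arbitrary: f rule: less_induct)
  case (less f)
  show ?case
  proof (cases "\<exists>k\<in>Basis. f k \<noteq> 0")
    case False
    then show ?thesis by simp
  next
    case True
    then obtain k where k: "k \<in> Basis" "f k \<noteq> 0" by blast
    define h where "h = (\<lambda>x. f x - ((f x \<bullet> k) / (f k \<bullet> k)) *\<^sub>R f k)"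
    have sym: "f x \<bullet> y = x \<bullet> f y" "g x \<bullet> y = x \<bullet> g y"
      and pos: "0 \<le> f x \<bullet> x" "0 \<le> g x \<bullet> x" for x y
      using less.prems g by (auto simp: pos_selfadjoint_def)
    have "h k = 0"
      using pos_selfadjoint_eq_0[OF less.prems, of k] k(2) by (auto simp: h_def)
    moreover have "h b = 0" if "f b = 0" for b
      using that by (simp add: h_def)
    ultimately have "{b \<in> Basis. h b \<noteq> 0} \<subset> {b \<in> Basis. f b \<noteq> 0}"
      using k by blast
    then have "card {b \<in> Basis. h b \<noteq> 0} < card {b \<in> Basis. f b \<noteq> 0}"
      by (intro psubset_card_mono) auto
    then have "0 \<le> (\<Sum>b\<in>Basis. h b \<bullet> g b)"
      using less.hyps pos_selfadjoint_deflate[OF less.prems k(2)] by (simp add: h_def)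
    \<comment> \<open>Self-adjointness of \<open>f\<close> and \<open>g\<close> turns the
      contribution of the removed rank-one part into the basis expansion of the form of
      \<open>g\<close> at \<open>f k\<close>, divided by the form of \<open>f\<close> at
      \<open>k\<close>; both are nonnegative.\<close>
    moreover have "(\<Sum>b\<in>Basis. f b \<bullet> g b)
        = (\<Sum>b\<in>Basis. h b \<bullet> g b) + (g (f k) \<bullet> f k) / (f k \<bullet> k)"
    proof -
      have "(\<Sum>b\<in>Basis. (f b \<bullet> k) * (f k \<bullet> g b)) = (\<Sum>b\<in>Basis. (f k \<bullet> b) * (g (f k) \<bullet> b))"
      proof (intro sum.cong refl)
        fix b
        have "f b \<bullet> k = f k \<bullet> b" "f k \<bullet> g b = g (f k) \<bullet> b"
          by (metis sym inner_commute)+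
        then show "(f b \<bullet> k) * (f k \<bullet> g b) = (f k \<bullet> b) * (g (f k) \<bullet> b)"
          by simp
      qed
      also have "\<dots> = g (f k) \<bullet> f k"
        by (simp add: euclidean_inner[of "g (f k)" "f k"] mult.commute)
      finally have "(\<Sum>b\<in>Basis. (f b \<bullet> k) * (f k \<bullet> g b)) = g (f k) \<bullet> f k" .
      then show ?thesis
        by (simp add: h_def inner_diff_left sum_subtractf sum_divide_distrib[symmetric])
    qed
    ultimately show ?thesis using pos by simp
  qed
qed

text \<open>Cauchy-Schwarz for the form of \<open>f\<close>, taken at \<open>x\<close> and
  \<open>f x\<close>, bounds the fourth power of \<open>norm (f x)\<close> by two values of that
  form. Each is controlled by \<open>onorm h\<close>, and the square of \<open>norm (f x)\<close>
  cancels.\<close>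

lemma onorm_pos_selfadjoint_mono:
  fixes f h :: "'a::euclidean_space \<Rightarrow> 'a"
  assumes f: "pos_selfadjoint f" and h: "linear h" and le: "\<And>x. f x \<bullet> x \<le> h x \<bullet> x"
  shows "onorm f \<le> onorm h"
proof (rule onorm_bound)
  have bl: "bounded_linear h"
    using h by (simp add: linear_conv_bounded_linear)
  show "0 \<le> onorm h"
    using bl by (rule onorm_pos_le)
  have form: "f x \<bullet> x \<le> onorm h * (norm x)\<^sup>2" for x
  proof -
    have "f x \<bullet> x \<le> norm (h x) * norm x"
      using le[of x] norm_cauchy_schwarz[of "h x" x] by linarith
    also have "\<dots> \<le> (onorm h * norm x) * norm x"
      using onorm[OF bl] by (intro mult_right_mono) auto
    finally show ?thesis by (simp add: power2_eq_square mult.assoc)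
  qed
  show "norm (f x) \<le> onorm h * norm x" for x
  proof (cases "f x = 0")
    case True
    then show ?thesis using \<open>0 \<le> onorm h\<close> by simp
  next
    case False
    let ?y = "f x"
    have "(?y \<bullet> ?y)\<^sup>2 \<le> (f x \<bullet> x) * (f ?y \<bullet> ?y)"
      by (rule pos_selfadjoint_Cauchy_Schwarz[OF f])
    also have "\<dots> \<le> (onorm h * (norm x)\<^sup>2) * (onorm h * (norm ?y)\<^sup>2)"
      using f by (intro mult_mono form) (auto simp: pos_selfadjoint_nonneg \<open>0 \<le> onorm h\<close>)
    finally have "(norm ?y)\<^sup>2 * (norm ?y)\<^sup>2 \<le> (onorm h * norm x)\<^sup>2 * (norm ?y)\<^sup>2"
      by (simp add: dot_square_norm power2_eq_square algebra_simps)
    then have "(norm ?y)\<^sup>2 \<le> (onorm h * norm x)\<^sup>2"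
      using False by (simp only: mult_le_cancel_right zero_less_power2 norm_eq_zero) simp
    then show ?thesis
      by (rule power2_le_imp_le) (simp add: \<open>0 \<le> onorm h\<close>)
  qed
qed

section \<open>Monotonicity of both norms for positive semi-definite matrices\<close>

lemma hermitian_psd_pos_selfadjoint:
  assumes "hermitian_psd A"
  shows "pos_selfadjoint ((*v) A)"
proof -
  have "conj_transpose A = A"
    using assms by (simp add: hermitian_psd_def hermitian_def)
  then have "(A *v x) \<bullet> y = x \<bullet> (A *v y)" for x y
    by (metis inner_matrix_vector_conj_transpose)
  moreover have "(A *v x) \<bullet> x = Re (\<Sum>i\<in>UNIV. cnj (x $ i) * (A *v x) $ i)" for x
    by (subst inner_commute) (simp add: inner_vec_def inner_complex_eq)
  ultimately show ?thesis
    using assms by (simp add: pos_selfadjoint_def hermitian_psd_def)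
qed

text \<open>In the expansion of the squared norm of \<open>A + E\<close> the cross term is twice
  \<open>A \<bullet> E\<close>, which is half of the nonnegative sum over
  \<open>Basis\<close>.\<close>

lemma frobenius_norm_psd_mono:
  assumes "hermitian_psd A" "hermitian_psd E"
  shows "frobenius_norm A \<le> frobenius_norm (A + E)"
proof -
  have "0 \<le> A \<bullet> E"
    using pos_selfadjoint_trace_nonneg[OF assms[THEN hermitian_psd_pos_selfadjoint]]
    by (simp add: sum_Basis_inner_matrix)
  then have "(norm A)\<^sup>2 \<le> (norm (A + E))\<^sup>2"
    by (simp add: power2_norm_eq_inner inner_add_left inner_add_right inner_commute)
  then show ?thesis
    by (simp add: frobenius_norm_eq_norm)
qed

lemma two_norm_psd_mono:
  assumes "hermitian_psd A" "hermitian_psd E"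
  shows "two_norm A \<le> two_norm (A + E)"
  unfolding two_norm_def
proof (rule onorm_pos_selfadjoint_mono)
  show "(A *v x) \<bullet> x \<le> ((A + E) *v x) \<bullet> x" for x
    using pos_selfadjoint_nonneg[OF hermitian_psd_pos_selfadjoint[OF assms(2)]]
    by (simp add: matrix_vector_mult_add_rdistrib inner_add_left)
qed (use assms hermitian_psd_pos_selfadjoint in auto)

section \<open>Two-norm basics and the stable rank bounds\<close>

lemma two_norm_triangle: "two_norm (A + E) \<le> two_norm A + two_norm E"
  using onorm_triangle[of "(*v) A" "(*v) E"]
  by (simp add: two_norm_def matrix_vector_mult_add_rdistrib)

lemma two_norm_minus: "two_norm (- A) = two_norm A"
proof -
  have "(- A) *v x = - (A *v x)" for x
    by (simp add: vec_eq_iff matrix_vector_mult_def sum_negf)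
  then show ?thesis
    by (simp add: two_norm_def onorm_neg)
qed

lemma two_norm_nonneg: "0 \<le> two_norm A"
  by (simp add: two_norm_def onorm_pos_le)

lemma two_norm_pos_iff: "0 < two_norm A \<longleftrightarrow> A \<noteq> 0"
  by (auto simp: two_norm_def onorm_pos_lt matrix_eq)

text \<open>The zero matrix fits the quotient formula too, since both sides are then 0.\<close>

lemma sqrt_stable_rank: "sqrt (stable_rank A) = frobenius_norm A / two_norm A"
  by (simp add: stable_rank_def real_sqrt_divide frobenius_norm_eq_norm two_norm_nonneg)

theorem corollary5p19:
  shows "(\<forall>(A :: complex ^ 'n ^ 'm) (E :: complex ^ 'n ^ 'm) (r :: nat) (\<epsilon> :: real).
            A \<noteq> 0 \<longrightarrow> r = rank E \<longrightarrow> \<epsilon> = two_norm E / two_norm A \<longrightarrow> \<epsilon> < 1 \<longrightarrow>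
              1 / (1 + \<epsilon>) * (sqrt (stable_rank A) - sqrt (real r) * \<epsilon>) \<le> sqrt (stable_rank (A + E)) \<and>
              sqrt (stable_rank (A + E)) \<le> 1 / (1 - \<epsilon>) * (sqrt (stable_rank A) + sqrt (real r) * \<epsilon>))
       \<and> (\<forall>(A :: complex ^ 'n ^ 'n) (E :: complex ^ 'n ^ 'n) (r :: nat) (\<epsilon> :: real).
            A \<noteq> 0 \<longrightarrow> r = rank E \<longrightarrow> \<epsilon> = two_norm E / two_norm A \<longrightarrow> \<epsilon> < 1 \<longrightarrow>
            hermitian_psd A \<longrightarrow> hermitian_psd E \<longrightarrow>
              sqrt (stable_rank A) / (1 + \<epsilon>) \<le> sqrt (stable_rank (A + E)) \<and>
              sqrt (stable_rank (A + E)) \<le> sqrt (stable_rank A) + sqrt (real r) * \<epsilon>)"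
proof (intro conjI allI impI)
  fix A E :: "complex ^ 'n ^ 'm" and r :: nat and \<epsilon> :: real
  assume A: "A \<noteq> 0" and r: "r = rank E" and \<epsilon>: "\<epsilon> = two_norm E / two_norm A" and "\<epsilon> < 1"
  let ?s = "two_norm A" and ?t = "two_norm (A + E)"
  have s: "0 < ?s"
    using A by (simp add: two_norm_pos_iff)
  have E: "two_norm E = \<epsilon> * ?s"
    using s by (simp add: \<epsilon>)
  have "0 \<le> \<epsilon>"
    using s by (simp add: \<epsilon> two_norm_nonneg)
  have upper: "?t \<le> (1 + \<epsilon>) * ?s"
    using two_norm_triangle[of A E] by (simp add: E algebra_simps)
  \<comment> \<open>Reverse triangle inequality, from writing \<open>A\<close> as the sum of
    \<open>A + E\<close> and \<open>- E\<close>.\<close>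
  have lower: "(1 - \<epsilon>) * ?s \<le> ?t"
    using two_norm_triangle[of "A + E" "- E"] by (simp add: two_norm_minus E algebra_simps)
  then have t: "0 < ?t"
    using s \<open>\<epsilon> < 1\<close> by (smt (verit) mult_pos_pos)
  have FE: "frobenius_norm E \<le> sqrt r * \<epsilon> * ?s"
    using frobenius_norm_le_rank_two_norm[of E] by (simp add: r E mult.assoc)
  show "1 / (1 + \<epsilon>) * (sqrt (stable_rank A) - sqrt (real r) * \<epsilon>) \<le> sqrt (stable_rank (A + E))"
  proof -
    have "1 / (1 + \<epsilon>) * (sqrt (stable_rank A) - sqrt (real r) * \<epsilon>)
        = (frobenius_norm A - sqrt r * \<epsilon> * ?s) / ((1 + \<epsilon>) * ?s)"
      using s \<open>0 \<le> \<epsilon>\<close> by (simp add: sqrt_stable_rank field_simps)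
    \<comment> \<open>The numerator on the left may be negative, so it is replaced by a nonnegative
      one before the denominators are compared.\<close>
    also have "\<dots> \<le> frobenius_norm (A + E) / ((1 + \<epsilon>) * ?s)"
      using FE norm_triangle_ineq4[of "A + E" E] s \<open>0 \<le> \<epsilon>\<close>
      by (intro divide_right_mono) (auto simp: frobenius_norm_eq_norm)
    also have "\<dots> \<le> frobenius_norm (A + E) / ?t"
      using upper t s \<open>0 \<le> \<epsilon>\<close> by (intro divide_left_mono) (auto simp: frobenius_norm_eq_norm)
    finally show ?thesis by (simp add: sqrt_stable_rank)
  qed
  show "sqrt (stable_rank (A + E)) \<le> 1 / (1 - \<epsilon>) * (sqrt (stable_rank A) + sqrt (real r) * \<epsilon>)"
  proof -
    have "frobenius_norm (A + E) / ?t \<le> frobenius_norm (A + E) / ((1 - \<epsilon>) * ?s)"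
      using lower t s \<open>\<epsilon> < 1\<close> by (intro divide_left_mono) (auto simp: frobenius_norm_eq_norm)
    also have "\<dots> \<le> (frobenius_norm A + sqrt r * \<epsilon> * ?s) / ((1 - \<epsilon>) * ?s)"
      using FE norm_triangle_ineq[of A E] s \<open>\<epsilon> < 1\<close>
      by (intro divide_right_mono) (auto simp: frobenius_norm_eq_norm)
    also have "\<dots> = 1 / (1 - \<epsilon>) * (sqrt (stable_rank A) + sqrt (real r) * \<epsilon>)"
      using s \<open>\<epsilon> < 1\<close> by (simp add: sqrt_stable_rank field_simps)
    finally show ?thesis by (simp add: sqrt_stable_rank)
  qed
next
  fix A E :: "complex ^ 'n ^ 'n" and r :: nat and \<epsilon> :: real
  assume A: "A \<noteq> 0" and r: "r = rank E" and \<epsilon>: "\<epsilon> = two_norm E / two_norm A"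
    and psd: "hermitian_psd A" "hermitian_psd E"
  let ?s = "two_norm A" and ?t = "two_norm (A + E)"
  have s: "0 < ?s"
    using A by (simp add: two_norm_pos_iff)
  have E: "two_norm E = \<epsilon> * ?s"
    using s by (simp add: \<epsilon>)
  have "0 \<le> \<epsilon>"
    using s by (simp add: \<epsilon> two_norm_nonneg)
  have upper: "?t \<le> (1 + \<epsilon>) * ?s"
    using two_norm_triangle[of A E] by (simp add: E algebra_simps)
  \<comment> \<open>Monotonicity improves the factor \<open>1 - \<epsilon>\<close> of the general
    case to 1.\<close>
  have lower: "?s \<le> ?t"
    using psd by (rule two_norm_psd_mono)
  have FE: "frobenius_norm E \<le> sqrt r * \<epsilon> * ?s"
    using frobenius_norm_le_rank_two_norm[of E] by (simp add: r E mult.assoc)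
  show "sqrt (stable_rank A) / (1 + \<epsilon>) \<le> sqrt (stable_rank (A + E))"
  proof -
    have "sqrt (stable_rank A) / (1 + \<epsilon>) = frobenius_norm A / ((1 + \<epsilon>) * ?s)"
      by (simp add: sqrt_stable_rank mult.commute)
    \<comment> \<open>Monotonicity of the Frobenius norm bounds the numerator with no loss of a rank
      term.\<close>
    also have "\<dots> \<le> frobenius_norm (A + E) / ?t"
      using frobenius_norm_psd_mono[OF psd] upper lower s
      by (intro frac_le) (auto simp: frobenius_norm_eq_norm)
    finally show ?thesis by (simp add: sqrt_stable_rank)
  qed
  show "sqrt (stable_rank (A + E)) \<le> sqrt (stable_rank A) + sqrt (real r) * \<epsilon>"
  proof -
    have "frobenius_norm (A + E) / ?t \<le> (frobenius_norm A + sqrt r * \<epsilon> * ?s) / ?s"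
      using FE norm_triangle_ineq[of A E] lower s \<open>0 \<le> \<epsilon>\<close>
      by (intro frac_le) (auto simp: frobenius_norm_eq_norm)
    also have "\<dots> = sqrt (stable_rank A) + sqrt (real r) * \<epsilon>"
      using s by (simp add: sqrt_stable_rank field_simps)
    finally show ?thesis by (simp add: sqrt_stable_rank)
  qed
qed

end
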